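(* Let $\varepsilon,\mu\in L^\infty(\Omega;\mathbb{C}^{3\times3})$ be elliptic tensor fields such that $\varepsilon$ and $-\mu^{-1}$ are simultaneously elliptic, and let $\Theta:=\Theta_\varepsilon\cap\Theta_{-\mu^{-1}}$ be the (nonempty) intersection of their $\Theta$-sets. Consider the sesquilinear form $$a(\mathbf{u},\mathbf{v})=(\mu^{-1}\,\mathbf{curl}\,\mathbf{u},\mathbf{curl}\,\mathbf{v})_\Omega-\omega^2(\varepsilon\mathbf{u},\mathbf{v})_\Omega ,$$ defined on $\mathbf{H}_0(\mathbf{curl},\Omega)$ (Dirichlet problem, $a=a_{\mathrm D}$) or on $\mathbf{H}(\mathbf{curl},\Omega)$ (Neumann problem, $a=a_{\mathrm N}$). Then both sesquilinear forms are coercive for every $\theta_{\mathrm{coe}}\in\Theta$, with coercivity constant $C_{\mathrm{coe}}=\min(\mu_-\mu_+^{-2},\,\omega^2\varepsilon_-)$, which depends on $\theta_{\mathrm{coe}}$; that is, $\mathrm{Re}\{-e^{i\theta_{\mathrm{coe}}}a(\mathbf{u},\mathbf{u})\}\ge C_{\mathrm{coe}}\|\mathbf{u}\|^2_{\mathbf{H}(\mathbf{curl},\Omega)}$ for all $\mathbf{u}$ in the respective space.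
   Context: $\Omega\subset\mathbb{R}^3$ is an open, connected, bounded set with Lipschitz boundary $\Gamma$ and unit outward normal $\mathbf{n}$; $\omega>0$ is a real constant. $(\mathbf{a},\mathbf{b})_\Omega=\int_\Omega\mathbf{a}\cdot\overline{\mathbf{b}}\,d\mathbf{x}$. $\mathbf{H}(\mathbf{curl},\Omega)=\{\mathbf{v}\in\mathbf{L}^2(\Omega):\mathbf{curl}\,\mathbf{v}\in\mathbf{L}^2(\Omega)\}$ (complex-valued fields) with norm $\|\mathbf{v}\|^2_{\mathbf{H}(\mathbf{curl},\Omega)}=\|\mathbf{v}\|^2_{\mathbf{L}^2(\Omega)}+\|\mathbf{curl}\,\mathbf{v}\|^2_{\mathbf{L}^2(\Omega)}$; $\mathbf{H}_0(\mathbf{curl},\Omega)$ is its subspace of fields with zero tangential trace $\mathbf{v}\times\mathbf{n}|_\Gamma=0$. A tensor field $\xi\in L^\infty(\Omega;\mathbb{C}^{3\times3})$ is elliptic if there exist $\theta\in\mathbb{R}$ and $\xi_->0$ such that, for a.e. $\mathbf{x}\in\Omega$ and all $\mathbf{z}\in\mathbb{C}^3$, $\mathrm{Re}\{e^{i\theta}(\xi(\mathbf{x})\mathbf{z})\cdot\overline{\mathbf{z}}\}\ge\xi_-|\mathbf{z}|^2$; such a $\theta$ is an ellipticity direction, and $\Theta_\xi$ is the set of all ellipticity directions in $[-\pi,\pi]$. Set $\xi_+:=\|\xi\|_{L^\infty(\Omega)}=\operatorname{ess\,sup}_{\mathbf{x}}\sup_{\mathbf{z}\ne0}|\xi(\mathbf{x})\mathbf{z}|/|\mathbf{z}|$.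 Two elliptic tensor fields are simultaneously elliptic if their $\Theta$-sets intersect. An elliptic tensor field is a.e. invertible with inverse in $L^\infty$. Constants: given $\theta_{\mathrm{coe}}\in\Theta$, $\varepsilon_->0$ is any constant such that a.e., for all $\mathbf{z}\in\mathbb{C}^3$, $\mathrm{Re}\{e^{i\theta_{\mathrm{coe}}}(\varepsilon\mathbf{z})\cdot\overline{\mathbf{z}}\}\ge\varepsilon_-|\mathbf{z}|^2$, and $\mu_->0$ is any constant such that a.e., for all $\mathbf{z}\in\mathbb{C}^3$, $-\mathrm{Re}\{e^{-i\theta_{\mathrm{coe}}}(\mu\mathbf{z})\cdot\overline{\mathbf{z}}\}\ge\mu_-|\mathbf{z}|^2$ (ellipticity constant of $\mu$ for the direction $\pi-\theta_{\mathrm{coe}}$ modulo $2\pi$). A sesquilinear form $a$ on a Hilbert space $V$ is coercive (for the direction $\theta_{\mathrm{coe}}\in\mathbb{R}$, with constant $C_{\mathrm{coe}}>0$) if $\mathrm{Re}\{-e^{i\theta_{\mathrm{coe}}}a(\mathbf{u},\mathbf{u})\}\ge C_{\mathrm{coe}}\|\mathbf{u}\|_V^2$ for all $\mathbf{u}\in V$. *)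

theory Defs
  imports "HOL-Analysis.Analysis" "HOL-Probability.Essential_Supremum"
begin

text \<open>
  Complex vector and tensor fields on a domain \<open>\<Omega>\<close> are represented by total functions on the whole
  of \<open>\<real>\<^sup>3\<close>; only their values almost everywhere on \<open>\<Omega>\<close> matter.  Function spaces are accordingly sets
  of representatives, and all integrals are Lebesgue integrals over \<open>\<Omega>\<close>.
\<close>

type_synonym cfield = "real^3 \<Rightarrow> complex^3"
type_synonym tensor_field = "real^3 \<Rightarrow> complex^3^3"


subsection \<open>Lipschitz domains\<close>

text \<open>
  Near every boundary point, in suitable rotated Cartesian coordinates \<open>T x\<close>, the set is the
  strict epigraph of a Lipschitz function of the first two coordinates.  (The translation part of
  the coordinate change is absorbed by \<open>g\<close>.)
\<close>

definition lipschitz_boundary :: "(real^3) set \<Rightarrow> bool" where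
  "lipschitz_boundary \<Omega> \<longleftrightarrow>
     (\<forall>p \<in> frontier \<Omega>. \<exists>U (T :: real^3 \<Rightarrow> real^3) (g :: real^2 \<Rightarrow> real) L.
        open U \<and> p \<in> U \<and> orthogonal_transformation T \<and> L-lipschitz_on UNIV g \<and>
        U \<inter> \<Omega> = {x \<in> U. g (vector [T x $ 1, T x $ 2]) < T x $ 3})"


subsection \<open>Smooth compactly supported functions\<close>

definition partial :: "3 \<Rightarrow> (real^3 \<Rightarrow> complex) \<Rightarrow> real^3 \<Rightarrow> complex" where
  "partial i f x = frechet_derivative f (at x) (axis i 1)"

fun cont_diff :: "nat \<Rightarrow> (real^3 \<Rightarrow> complex) \<Rightarrow> bool" where
  "cont_diff 0 f \<longleftrightarrow> continuous_on UNIV f"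
| "cont_diff (Suc k) f \<longleftrightarrow> f differentiable_on UNIV \<and> (\<forall>i. cont_diff k (partial i f))"

definition test_functions :: "(real^3) set \<Rightarrow> (real^3 \<Rightarrow> complex) set" where
  "test_functions \<Omega> =
     {f. (\<forall>k. cont_diff k f) \<and> (\<exists>K. compact K \<and> K \<subseteq> \<Omega> \<and> (\<forall>x. x \<notin> K \<longrightarrow> f x = 0))}"

definition test_fields :: "(real^3) set \<Rightarrow> cfield set" where
  "test_fields \<Omega> = {\<phi>. \<forall>j. (\<lambda>x. \<phi> x $ j) \<in> test_functions \<Omega>}"

definition classical_curl :: "cfield \<Rightarrow> cfield" where
  "classical_curl \<phi> x =
     (let D = (\<lambda>i j. partial i (\<lambda>y. \<phi> y $ j) x)
      in vector [D 2 3 - D 3 2, D 3 1 - D 1 3, D 1 2 - D 2 1])"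


subsection \<open>Square-integrable fields\<close>

text \<open>The product \<open>a \<cdot> conj b\<close>, linear in the first and antilinear in the second argument.\<close>

definition cdot :: "complex^3 \<Rightarrow> complex^3 \<Rightarrow> complex" where
  "cdot a b = (\<Sum>i\<in>UNIV. a $ i * cnj (b $ i))"

definition L2 :: "(real^3) set \<Rightarrow> cfield set" where
  "L2 \<Omega> = {u. u \<in> borel_measurable (lebesgue_on \<Omega>) \<and>
              integrable (lebesgue_on \<Omega>) (\<lambda>x. (norm (u x))\<^sup>2)}"

definition L2_inner :: "(real^3) set \<Rightarrow> cfield \<Rightarrow> cfield \<Rightarrow> complex" where
  "L2_inner \<Omega> u v = (\<integral>x. cdot (u x) (v x) \<partial>lebesgue_on \<Omega>)"

definition L2_norm :: "(real^3) set \<Rightarrow> cfield \<Rightarrow> real" where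
  "L2_norm \<Omega> u = sqrt (\<integral>x. (norm (u x))\<^sup>2 \<partial>lebesgue_on \<Omega>)"


subsection \<open>The spaces \<open>H(curl)\<close> and \<open>H\<^sub>0(curl)\<close>\<close>

definition is_weak_curl :: "(real^3) set \<Rightarrow> cfield \<Rightarrow> cfield \<Rightarrow> bool" where
  "is_weak_curl \<Omega> u w \<longleftrightarrow>
     (\<forall>\<phi> \<in> test_fields \<Omega>. L2_inner \<Omega> w \<phi> = L2_inner \<Omega> u (classical_curl \<phi>))"

definition H_curl :: "(real^3) set \<Rightarrow> cfield set" where
  "H_curl \<Omega> = {u \<in> L2 \<Omega>. \<exists>w \<in> L2 \<Omega>. is_weak_curl \<Omega> u w}"

text \<open>For \<open>u\<close> in \<open>H(curl)\<close> this is a representative of the weak curl, which is unique almost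
  everywhere on \<open>\<Omega>\<close>.\<close>

definition weak_curl :: "(real^3) set \<Rightarrow> cfield \<Rightarrow> cfield" where
  "weak_curl \<Omega> u = (SOME w. w \<in> L2 \<Omega> \<and> is_weak_curl \<Omega> u w)"

definition H_curl_norm :: "(real^3) set \<Rightarrow> cfield \<Rightarrow> real" where
  "H_curl_norm \<Omega> u = sqrt ((L2_norm \<Omega> u)\<^sup>2 + (L2_norm \<Omega> (weak_curl \<Omega> u))\<^sup>2)"

definition is_weak_partial ::
    "(real^3) set \<Rightarrow> 3 \<Rightarrow> (real^3 \<Rightarrow> complex) \<Rightarrow> (real^3 \<Rightarrow> complex) \<Rightarrow> bool" where
  "is_weak_partial \<Omega> i f g \<longleftrightarrow>
     (\<forall>\<psi> \<in> test_functions \<Omega>.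
        (\<integral>x. g x * \<psi> x \<partial>lebesgue_on \<Omega>) = - (\<integral>x. f x * partial i \<psi> x \<partial>lebesgue_on \<Omega>))"

definition H1_fields :: "(real^3) set \<Rightarrow> cfield set" where
  "H1_fields \<Omega> = {\<phi> \<in> L2 \<Omega>.
     \<forall>i. \<exists>\<gamma> \<in> L2 \<Omega>. \<forall>j. is_weak_partial \<Omega> i (\<lambda>x. \<phi> x $ j) (\<lambda>x. \<gamma> x $ j)}"

text \<open>
  The tangential trace \<open>v \<times> n\<close> of a field \<open>v\<close> in \<open>H(curl)\<close> of a bounded Lipschitz domain with
  boundary \<open>\<Gamma>\<close> and outward unit normal \<open>n\<close> is an element of \<open>H\<^bsup>-1/2\<^esup>(\<Gamma>)\<close>, defined by continuous
  extension of Green's formula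
    \<open>\<integral>\<^sub>\<Gamma> (v \<times> n) \<cdot> conj \<phi> dS = (v, curl \<phi>)\<^sub>\<Omega> - (curl v, \<phi>)\<^sub>\<Omega>\<close>
  from smooth fields.  Elements of \<open>H\<^bsup>1/2\<^esup>(\<Gamma>)\<close> are the traces of \<open>H\<^sup>1\<close> fields \<open>\<phi>\<close>; the duality
  pairing is expressed through such \<open>\<phi>\<close>.
\<close>

definition tangential_trace :: "(real^3) set \<Rightarrow> cfield \<Rightarrow> cfield \<Rightarrow> complex" where
  "tangential_trace \<Omega> v \<phi> = L2_inner \<Omega> v (weak_curl \<Omega> \<phi>) - L2_inner \<Omega> (weak_curl \<Omega> v) \<phi>"

definition H0_curl :: "(real^3) set \<Rightarrow> cfield set" where
  "H0_curl \<Omega> = {v \<in> H_curl \<Omega>. \<forall>\<phi> \<in> H1_fields \<Omega>. tangential_trace \<Omega> v \<phi> = 0}"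


subsection \<open>Elliptic tensor fields\<close>

definition Linf_norm :: "(real^3) set \<Rightarrow> tensor_field \<Rightarrow> ereal" where
  "Linf_norm \<Omega> \<xi> = esssup (lebesgue_on \<Omega>) (\<lambda>x. ereal (onorm ((*v) (\<xi> x))))"

definition Linf :: "(real^3) set \<Rightarrow> tensor_field set" where
  "Linf \<Omega> = {\<xi>. \<xi> \<in> borel_measurable (lebesgue_on \<Omega>) \<and> Linf_norm \<Omega> \<xi> < \<infinity>}"

definition elliptic_with :: "(real^3) set \<Rightarrow> tensor_field \<Rightarrow> real \<Rightarrow> real \<Rightarrow> bool" where
  "elliptic_with \<Omega> \<xi> \<theta> c \<longleftrightarrow>
     (AE x in lebesgue_on \<Omega>. \<forall>z. Re (cis \<theta> * cdot (\<xi> x *v z) z) \<ge> c * (norm z)\<^sup>2)"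

definition ellipticity_direction :: "(real^3) set \<Rightarrow> tensor_field \<Rightarrow> real \<Rightarrow> bool" where
  "ellipticity_direction \<Omega> \<xi> \<theta> \<longleftrightarrow> (\<exists>c>0. elliptic_with \<Omega> \<xi> \<theta> c)"

definition elliptic :: "(real^3) set \<Rightarrow> tensor_field \<Rightarrow> bool" where
  "elliptic \<Omega> \<xi> \<longleftrightarrow> \<xi> \<in> Linf \<Omega> \<and> (\<exists>\<theta>. ellipticity_direction \<Omega> \<xi> \<theta>)"

definition Theta_set :: "(real^3) set \<Rightarrow> tensor_field \<Rightarrow> real set" where
  "Theta_set \<Omega> \<xi> = {\<theta> \<in> {-pi..pi}. ellipticity_direction \<Omega> \<xi> \<theta>}"

definition simultaneously_elliptic ::
    "(real^3) set \<Rightarrow> tensor_field \<Rightarrow> tensor_field \<Rightarrow> bool" where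
  "simultaneously_elliptic \<Omega> \<xi> \<zeta> \<longleftrightarrow>
     elliptic \<Omega> \<xi> \<and> elliptic \<Omega> \<zeta> \<and> Theta_set \<Omega> \<xi> \<inter> Theta_set \<Omega> \<zeta> \<noteq> {}"


subsection \<open>The Maxwell form and coercivity\<close>

definition inv_field :: "tensor_field \<Rightarrow> tensor_field" where
  "inv_field \<xi> x = matrix_inv (\<xi> x)"

definition maxwell_form ::
    "(real^3) set \<Rightarrow> real \<Rightarrow> tensor_field \<Rightarrow> tensor_field \<Rightarrow> cfield \<Rightarrow> cfield \<Rightarrow> complex" where
  "maxwell_form \<Omega> \<omega> \<epsilon> \<mu> u v =
     L2_inner \<Omega> (\<lambda>x. inv_field \<mu> x *v weak_curl \<Omega> u x) (weak_curl \<Omega> v)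
     - of_real (\<omega>\<^sup>2) * L2_inner \<Omega> (\<lambda>x. \<epsilon> x *v u x) v"

definition coercive ::
    "'v set \<Rightarrow> ('v \<Rightarrow> real) \<Rightarrow> ('v \<Rightarrow> 'v \<Rightarrow> complex) \<Rightarrow> real \<Rightarrow> real \<Rightarrow> bool" where
  "coercive V N a \<theta> C \<longleftrightarrow> 0 < C \<and> (\<forall>u \<in> V. Re (- cis \<theta> * a u u) \<ge> C * (N u)\<^sup>2)"

end

theory Submission
  imports Defs
begin

text \<open>
  Pointwise, put \<open>z = \<mu>\<^bsup>-1\<^esup> w\<close> with \<open>w = curl u\<close>.  Then \<open>(\<mu>\<^bsup>-1\<^esup> w) \<cdot> conj w\<close> is the complex
  conjugate of \<open>(\<mu> z) \<cdot> conj z\<close>, so the ellipticity of \<open>\<mu>\<close> in the direction conjugate to \<open>\<theta>coe\<close>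
  bounds its rotated real part by \<open>\<mu>_minus |z|\<^sup>2\<close>, and \<open>|w| \<le> \<mu>_plus |z|\<close>.  Integrating this
  and the ellipticity bound of \<open>\<epsilon>\<close> over \<open>\<Omega>\<close> gives coercivity on all of \<open>H(curl)\<close>.
\<close>

lemma cdot_commute: "cdot a b = cnj (cdot b a)"
  by (simp add: cdot_def mult.commute)

lemma norm_cdot_le: "norm (cdot a b) \<le> norm a * norm b"
proof -
  have "norm (cdot a b) \<le> (\<Sum>i\<in>UNIV. \<bar>norm (a $ i)\<bar> * \<bar>norm (b $ i)\<bar>)"
    unfolding cdot_def by (rule order_trans[OF norm_sum]) (simp add: norm_mult)
  also have "\<dots> \<le> norm a * norm b"
    unfolding norm_vec_def by (rule L2_set_mult_ineq)
  finally show ?thesis .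
qed

lemma norm_matrix_vector_mult_le:
  fixes A :: "complex^3^3"
  shows "norm (A *v z) \<le> onorm ((*v) A) * norm z"
  by (rule onorm) (rule matrix_vector_mul_bounded_linear)

lemma onorm_AE_le_Linf_norm:
  "AE x in lebesgue_on \<Omega>. ereal (onorm ((*v) (\<xi> x))) \<le> Linf_norm \<Omega> \<xi>"
  unfolding Linf_norm_def by (rule esssup_AE)

text \<open>\<open>real_of_ereal\<close> sends both infinities to 0. Membership in
  \<open>Linf\<close> excludes the upper one, and the sign assumption excludes the value of minus
  infinity that an essential supremum can take over a null set.\<close>

lemma Linf_onorm_AE_le:
  assumes "\<xi> \<in> Linf \<Omega>" and "0 \<le> Linf_norm \<Omega> \<xi>"
  shows "AE x in lebesgue_on \<Omega>. onorm ((*v) (\<xi> x)) \<le> real_of_ereal (Linf_norm \<Omega> \<xi>)"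
proof -
  have eq: "Linf_norm \<Omega> \<xi> = ereal (real_of_ereal (Linf_norm \<Omega> \<xi>))"
    using assms by (intro ereal_real'[symmetric]) (auto simp: Linf_def)
  from onorm_AE_le_Linf_norm[of \<xi> \<Omega>] show ?thesis
    by (subst (asm) eq) simp
qed

text \<open>Combined with the essential supremum bound, the assumption gives almost everywhere an
  inequality between two constants. Over a space of nonzero measure such an inequality holds
  outright, since its failure would make the whole space null.\<close>

lemma Linf_norm_ge:
  assumes "emeasure (lebesgue_on \<Omega>) (space (lebesgue_on \<Omega>)) \<noteq> 0"
    and "AE x in lebesgue_on \<Omega>. c \<le> onorm ((*v) (\<xi> x))"
  shows "ereal c \<le> Linf_norm \<Omega> \<xi>"
proof -
  from onorm_AE_le_Linf_norm[of \<xi> \<Omega>] assms(2) have "AE x in lebesgue_on \<Omega>. ereal c \<le> Linf_norm \<Omega> \<xi>"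
    by eventually_elim (meson ereal_less_eq(3) order_trans)
  then show ?thesis
    using assms(1) by (cases "ereal c \<le> Linf_norm \<Omega> \<xi>") (auto simp: AE_iff_null null_sets_def)
qed

lemma emeasure_lebesgue_on_open_nonzero:
  assumes "open \<Omega>" and "\<Omega> \<noteq> {}"
  shows "emeasure (lebesgue_on \<Omega>) (space (lebesgue_on \<Omega>)) \<noteq> 0"
proof -
  have "\<Omega> \<in> sets lebesgue"
    using assms(1) by simp
  moreover have "\<not> negligible \<Omega>"
    using assms open_not_negligible by blast
  ultimately show ?thesis
    by (simp add: emeasure_restrict_space negligible_iff_emeasure0)
qed

text \<open>Any real bound suffices for integrability, so \<open>K\<close> is chosen without a sign
  condition on the norm; this also covers the value of minus infinity.\<close>

lemma Linf_AE_bounded: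
  assumes "\<xi> \<in> Linf \<Omega>"
  obtains K where "AE x in lebesgue_on \<Omega>. onorm ((*v) (\<xi> x)) \<le> K"
proof -
  obtain K where K: "Linf_norm \<Omega> \<xi> \<le> ereal K"
    using assms by (cases "Linf_norm \<Omega> \<xi>") (auto simp: Linf_def)
  from onorm_AE_le_Linf_norm[of \<xi> \<Omega>] have "AE x in lebesgue_on \<Omega>. onorm ((*v) (\<xi> x)) \<le> K"
    by eventually_elim (meson K ereal_less_eq(3) order_trans)
  then show thesis by (rule that)
qed

text \<open>The integrand is dominated by a multiple of the integrable function |u|^2. It is
  measurable because it is a jointly continuous function of the matrix and the vector.\<close>

lemma Linf_L2_integrable:
  assumes \<xi>: "\<xi> \<in> Linf \<Omega>" and u: "u \<in> L2 \<Omega>"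
  shows "integrable (lebesgue_on \<Omega>) (\<lambda>x. cdot (\<xi> x *v u x) (u x))"
proof -
  obtain K where K: "AE x in lebesgue_on \<Omega>. onorm ((*v) (\<xi> x)) \<le> K"
    using Linf_AE_bounded[OF \<xi>] .
  have meas: "(\<lambda>x. cdot (\<xi> x *v u x) (u x)) \<in> borel_measurable (lebesgue_on \<Omega>)"
  proof (rule borel_measurable_continuous_Pair[where H = "\<lambda>A v. cdot (A *v v) v"])
    show "\<xi> \<in> borel_measurable (lebesgue_on \<Omega>)" "u \<in> borel_measurable (lebesgue_on \<Omega>)"
      using \<xi> u by (auto simp: Linf_def L2_def)
    show "continuous_on UNIV (\<lambda>x. cdot (fst x *v snd x) (snd x))"
      unfolding cdot_def matrix_vector_mult_def vec_lambda_beta by (intro continuous_intros)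
  qed
  have bound: "AE x in lebesgue_on \<Omega>.
      norm (cdot (\<xi> x *v u x) (u x)) \<le> norm (K * (norm (u x))\<^sup>2)"
    using K
  proof eventually_elim
    case (elim x)
    have "norm (cdot (\<xi> x *v u x) (u x)) \<le> onorm ((*v) (\<xi> x)) * norm (u x) * norm (u x)"
      by (rule order_trans[OF norm_cdot_le mult_right_mono[OF norm_matrix_vector_mult_le]]) simp
    also have "\<dots> \<le> K * norm (u x) * norm (u x)"
      using elim by (intro mult_right_mono) auto
    finally show ?case
      by (simp add: power2_eq_square mult.assoc)
  qed
  show ?thesis
    by (rule Bochner_Integration.integrable_bound[OF _ meas bound])
      (use u in \<open>auto simp: L2_def\<close>)
qed

lemma L2_inner_lower_bound:
  assumes \<xi>: "\<xi> \<in> Linf \<Omega>" and u: "u \<in> L2 \<Omega>"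
    and lower: "AE x in lebesgue_on \<Omega>. \<forall>z. c * (norm z)\<^sup>2 \<le> Re (\<kappa> * cdot (\<xi> x *v z) z)"
  shows "c * (L2_norm \<Omega> u)\<^sup>2 \<le> Re (\<kappa> * L2_inner \<Omega> (\<lambda>x. \<xi> x *v u x) u)"
proof -
  have int: "integrable (lebesgue_on \<Omega>) (\<lambda>x. \<kappa> * cdot (\<xi> x *v u x) (u x))"
    using Linf_L2_integrable[OF \<xi> u] by simp
  have "c * (L2_norm \<Omega> u)\<^sup>2 = (\<integral>x. c * (norm (u x))\<^sup>2 \<partial>lebesgue_on \<Omega>)"
    by (simp add: L2_norm_def)
  also have "\<dots> \<le> (\<integral>x. Re (\<kappa> * cdot (\<xi> x *v u x) (u x)) \<partial>lebesgue_on \<Omega>)"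
  proof (rule integral_mono_AE)
    show "AE x in lebesgue_on \<Omega>. c * (norm (u x))\<^sup>2 \<le> Re (\<kappa> * cdot (\<xi> x *v u x) (u x))"
      using lower by eventually_elim blast
  qed (use u integrable_Re[OF int] in \<open>simp_all add: L2_def\<close>)
  also have "\<dots> = Re (\<kappa> * L2_inner \<Omega> (\<lambda>x. \<xi> x *v u x) u)"
    \<comment> \<open>\<open>Re\<close> of the product is kept whole so that it can be pulled out of
      the integral; integrability is what licenses this exchange.\<close>
    using int by (simp add: L2_inner_def del: times_complex.simps)
  finally show ?thesis .
qed

lemma weak_curl_in_L2:
  assumes "u \<in> H_curl \<Omega>"
  shows "weak_curl \<Omega> u \<in> L2 \<Omega>"
  using assms unfolding H_curl_def weak_curl_def
  by (metis (mono_tags, lifting) mem_Collect_eq someI_ex)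

text \<open>Testing with one unit vector is enough, because the rotation \<open>cis \<theta>\<close>
  has modulus 1. Applied to \<mu>, this yields the positivity of \<open>\<mu>_plus\<close>.\<close>

lemma positive_matrix_onorm_ge:
  fixes A :: "complex^3^3"
  assumes "\<And>z. c * (norm z)\<^sup>2 \<le> - Re (cis \<theta> * cdot (A *v z) z)"
  shows "c \<le> onorm ((*v) A)"
proof -
  define z :: "complex^3" where "z = axis 1 1"
  have z: "norm z = 1"
    by (simp add: z_def)
  have "c \<le> - Re (cis \<theta> * cdot (A *v z) z)"
    using assms[of z] z by simp
  also have "\<dots> \<le> norm (cdot (A *v z) z)"
    using abs_Re_le_cmod[of "cis \<theta> * cdot (A *v z) z"] by (simp add: norm_mult del: times_complex.simps)
  also have "\<dots> \<le> onorm ((*v) A)"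
    using norm_cdot_le[of "A *v z" z] norm_matrix_vector_mult_le[of A z] z by simp
  finally show ?thesis .
qed

lemma matrix_inv_elliptic:
  fixes A :: "complex^3^3"
  assumes "0 < c" and "0 < K"
    and lower: "\<And>z. c * (norm z)\<^sup>2 \<le> - Re (cis (- \<theta>) * cdot (A *v z) z)"
    and upper: "onorm ((*v) A) \<le> K"
  shows "c / K\<^sup>2 * (norm w)\<^sup>2 \<le> Re (- cis \<theta> * cdot (matrix_inv A *v w) w)"
proof -
  have "inj ((*v) A)"
  proof (rule injI)
    fix y z assume "A *v y = A *v z"
    then have "A *v (y - z) = 0"
      by (simp add: matrix_vector_mult_diff_distrib)
    \<comment> \<open>On a kernel vector the right side of \<open>lower\<close> vanishes, which
      forces its norm to be 0.\<close>
    with lower[of "y - z"] \<open>0 < c\<close> show "y = z"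
      by (simp add: cdot_def mult_le_0_iff)
  qed
  then have "invertible A"
    by (simp add: invertible_left_inverse matrix_left_invertible_injective)
  \<comment> \<open>\<open>matrix_inv\<close> is a choice term, and it is a true inverse once one is
    known to exist.\<close>
  then have "A ** matrix_inv A = mat 1"
    unfolding invertible_def matrix_inv_def by (rule someI_ex[THEN conjunct1])
  define z where "z = matrix_inv A *v w"
  have w: "w = A *v z"
    by (simp add: z_def matrix_vector_mul_assoc \<open>A ** matrix_inv A = mat 1\<close>)
  have "norm w \<le> K * norm z"
    unfolding w using norm_matrix_vector_mult_le upper
    by (meson mult_right_mono norm_ge_zero order_trans)
  then have "(norm w)\<^sup>2 \<le> K\<^sup>2 * (norm z)\<^sup>2"
    by (metis norm_ge_zero power_mono power_mult_distrib)
  then have "c / K\<^sup>2 * (norm w)\<^sup>2 \<le> c * (norm z)\<^sup>2"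
    using assms(1,2) by (simp add: field_simps)
  also have "\<dots> \<le> - Re (cis (- \<theta>) * cdot w z)"
    using lower[of z] by (simp only: w)
  \<comment> \<open>Conjugation preserves the real part, swaps the arguments of \<open>cdot\<close>
    and reverses the angle.\<close>
  also have "cis (- \<theta>) * cdot w z = cnj (cis \<theta> * cdot z w)"
    by (simp only: cdot_commute[of w z] cis_cnj complex_cnj_mult)
  finally show ?thesis
    by (simp add: z_def)
qed

lemma H0_curl_subset: "H0_curl \<Omega> \<subseteq> H_curl \<Omega>"
  by (auto simp: H0_curl_def)

lemma coercive_subset: "coercive V N a \<theta> C \<Longrightarrow> W \<subseteq> V \<Longrightarrow> coercive W N a \<theta> C"
  by (auto simp: coercive_def)

theorem proposition4p13:
  fixes \<Omega> :: "(real^3) set" and \<omega> :: real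
    and \<epsilon> \<mu> :: "real^3 \<Rightarrow> complex^3^3"
    and \<theta>coe \<epsilon>_minus \<mu>_minus \<mu>_plus :: real
  assumes "open \<Omega>" and "connected \<Omega>" and "bounded \<Omega>" and "\<Omega> \<noteq> {}"
    and "lipschitz_boundary \<Omega>"
    and "\<omega> > 0"
    and "elliptic \<Omega> \<epsilon>" and "elliptic \<Omega> \<mu>"
    and "simultaneously_elliptic \<Omega> \<epsilon> (\<lambda>x. - inv_field \<mu> x)"
    and "\<theta>coe \<in> Theta_set \<Omega> \<epsilon> \<inter> Theta_set \<Omega> (\<lambda>x. - inv_field \<mu> x)"
    and "\<epsilon>_minus > 0"
    and "AE x in lebesgue_on \<Omega>. \<forall>z. Re (cis \<theta>coe * cdot (\<epsilon> x *v z) z) \<ge> \<epsilon>_minus * (norm z)\<^sup>2"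
    and "\<mu>_minus > 0"
    and "AE x in lebesgue_on \<Omega>. \<forall>z. - Re (cis (- \<theta>coe) * cdot (\<mu> x *v z) z) \<ge> \<mu>_minus * (norm z)\<^sup>2"
    and "\<mu>_plus = real_of_ereal (Linf_norm \<Omega> \<mu>)"
  shows "coercive (H0_curl \<Omega>) (H_curl_norm \<Omega>) (maxwell_form \<Omega> \<omega> \<epsilon> \<mu>) \<theta>coe
           (min (\<mu>_minus * \<mu>_plus powi (-2)) (\<omega>\<^sup>2 * \<epsilon>_minus))
       \<and> coercive (H_curl \<Omega>) (H_curl_norm \<Omega>) (maxwell_form \<Omega> \<omega> \<epsilon> \<mu>) \<theta>coe
           (min (\<mu>_minus * \<mu>_plus powi (-2)) (\<omega>\<^sup>2 * \<epsilon>_minus))"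
proof -
  let ?\<mu>i = "inv_field \<mu>"
  let ?C = "min (\<mu>_minus * \<mu>_plus powi (-2)) (\<omega>\<^sup>2 * \<epsilon>_minus)"
  \<comment> \<open>Measurability and essential boundedness of the negated inverse are part of
    simultaneous ellipticity.\<close>
  have \<epsilon>: "\<epsilon> \<in> Linf \<Omega>" and \<mu>: "\<mu> \<in> Linf \<Omega>" and neg: "(\<lambda>x. - ?\<mu>i x) \<in> Linf \<Omega>"
    using assms(7-9) by (auto simp: elliptic_def simultaneously_elliptic_def)
  have "AE x in lebesgue_on \<Omega>. \<mu>_minus \<le> onorm ((*v) (\<mu> x))"
    using assms(14) by eventually_elim (blast intro: positive_matrix_onorm_ge)
  then have ge: "ereal \<mu>_minus \<le> Linf_norm \<Omega> \<mu>"
    by (intro Linf_norm_ge emeasure_lebesgue_on_open_nonzero assms)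
  \<comment> \<open>The extended norm is finite and at least \<open>\<mu>_minus\<close>, so
    \<open>\<mu>_plus\<close> is its genuine value and not the default 0.\<close>
  then have plus_pos: "0 < \<mu>_plus"
    using assms(13,15) \<mu> by (cases "Linf_norm \<Omega> \<mu>") (auto simp: Linf_def)
  have upper: "AE x in lebesgue_on \<Omega>. onorm ((*v) (\<mu> x)) \<le> \<mu>_plus"
    unfolding assms(15) using ge assms(13)
    by (intro Linf_onorm_AE_le \<mu>) (metis ereal_less_eq(5) less_imp_le order_trans)
  have neg_mult: "(- A) *v z = - (A *v z)" for A :: "complex^3^3" and z
    by (simp add: vec_eq_iff matrix_vector_mult_def sum_negf)
  have cdot_neg: "cdot (- a) b = - cdot a b" for a b
    by (simp add: cdot_def sum_negf)
  \<comment> \<open>The bound is phrased for the negated inverse to match \<open>neg\<close>; the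
    sign is moved out again after integration.\<close>
  have lower: "AE x in lebesgue_on \<Omega>. \<forall>z.
      \<mu>_minus / \<mu>_plus\<^sup>2 * (norm z)\<^sup>2 \<le> Re (cis \<theta>coe * cdot ((- ?\<mu>i x) *v z) z)"
    using assms(14) upper
  proof eventually_elim
    case (elim x)
    show ?case
      using matrix_inv_elliptic[OF assms(13) plus_pos _ elim(2), of \<theta>coe] elim(1)
      by (simp add: neg_mult cdot_neg inv_field_def)
  qed
  have powi: "\<mu>_plus powi (-2) = 1 / \<mu>_plus\<^sup>2"
    by (simp add: power_int_minus field_simps)
  have "coercive (H_curl \<Omega>) (H_curl_norm \<Omega>) (maxwell_form \<Omega> \<omega> \<epsilon> \<mu>) \<theta>coe ?C"
    unfolding coercive_def
  proof (intro conjI ballI)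
    show "0 < ?C"
      using assms(6,11,13) plus_pos by (simp add: powi)
    fix u assume "u \<in> H_curl \<Omega>"
    then have u: "u \<in> L2 \<Omega>" and w: "weak_curl \<Omega> u \<in> L2 \<Omega>"
      by (auto simp: H_curl_def weak_curl_in_L2)
    let ?w = "weak_curl \<Omega> u"
    let ?P = "L2_inner \<Omega> (\<lambda>x. ?\<mu>i x *v ?w x) ?w"
    let ?Q = "L2_inner \<Omega> (\<lambda>x. \<epsilon> x *v u x) u"
    have P: "\<mu>_minus / \<mu>_plus\<^sup>2 * (L2_norm \<Omega> ?w)\<^sup>2 \<le> - Re (cis \<theta>coe * ?P)"
      using L2_inner_lower_bound[OF neg w lower] by (simp add: neg_mult cdot_neg L2_inner_def)
    have Q: "\<epsilon>_minus * (L2_norm \<Omega> u)\<^sup>2 \<le> Re (cis \<theta>coe * ?Q)"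
      by (rule L2_inner_lower_bound[OF \<epsilon> u assms(12)])
    have "?C * (H_curl_norm \<Omega> u)\<^sup>2 = ?C * (L2_norm \<Omega> ?w)\<^sup>2 + ?C * (L2_norm \<Omega> u)\<^sup>2"
      by (simp add: H_curl_norm_def algebra_simps)
    \<comment> \<open>The minimum is relaxed to its first entry on the curl term and to its second
      on the field term.\<close>
    also have "\<dots> \<le> \<mu>_minus / \<mu>_plus\<^sup>2 * (L2_norm \<Omega> ?w)\<^sup>2 + \<omega>\<^sup>2 * \<epsilon>_minus * (L2_norm \<Omega> u)\<^sup>2"
      by (intro add_mono mult_right_mono) (auto simp: powi)
    also have "\<dots> \<le> - Re (cis \<theta>coe * ?P) + \<omega>\<^sup>2 * Re (cis \<theta>coe * ?Q)"
      using P mult_left_mono[OF Q, of "\<omega>\<^sup>2"] by (simp add: mult.assoc)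
    also have "\<dots> = Re (- cis \<theta>coe * maxwell_form \<Omega> \<omega> \<epsilon> \<mu> u u)"
      by (simp add: maxwell_form_def algebra_simps)
    finally show "?C * (H_curl_norm \<Omega> u)\<^sup>2 \<le> Re (- cis \<theta>coe * maxwell_form \<Omega> \<omega> \<epsilon> \<mu> u u)" .
  qed
  \<comment> \<open>The Dirichlet case restricts the same form, norm and constant to a subset of
    \<open>H_curl \<Omega>\<close>.\<close>
  then show ?thesis
    using coercive_subset H0_curl_subset by blast
qed

end
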